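(* Let $c\ge 1$ and $d\ge 0$ be integers, let $f_1,\dots,f_c$ be distinct arithmetical functions and let $(l_1,\dots,l_c)$ be a $c$-tuple of positive integers. Then: (i) Let $\{x_i\}_{i=1}^{\infty}$ be any strictly increasing infinite sequence of positive integers and $S_n=\{x_1,\dots,x_n\}$. If $f_1,\dots,f_c\in\mathcal{C}_{S_n}$ (respectively $f_1,\dots,f_c\in\mathcal{C}$) and $l_1+\dots+l_c>d$, then $f_1^{(l_1)}*\dots*f_c^{(l_c)}*\mu^{(d)}\in\mathcal{C}_{S_n}$ (respectively $\in\mathcal{C}$). (ii) For any prime $p$, $$(f_1^{(l_1)}*\dots*f_c^{(l_c)}*\mu^{(d)})(p)=\sum_{i=1}^c l_i f_i(p) f_i(1)^{l_i-1}\prod_{j=1,\,j\ne i}^c f_j(1)^{l_j}-d\prod_{i=1}^c f_i(1)^{l_i}.$$ Furthermore, if $f_1,\dots,f_c$ are multiplicative, then $(f_1^{(l_1)}*\dots*f_c^{(l_c)}*\mu^{(d)})(p)=\sum_{i=1}^c l_i f_i(p)-d$ if $f_i(1)=1$ for all $1\le i\le c$, and $(f_1^{(l_1)}*\dots*f_c^{(l_c)}*\mu^{(d)})(p)=0$ if $f_i(1)=0$ for some $1\le i\le c$.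
   Context: An arithmetical function is a complex-valued function on the positive integers; $*$ denotes Dirichlet convolution $(f*g)(m)=\sum_{d\mid m}f(d)g(m/d)$, and $\mu$ is the Möbius function. For an arithmetical function $f$ and integer $c\ge 0$, $f^{(0)}=\delta$ (where $\delta(1)=1$, $\delta(m)=0$ for $m>1$) and $f^{(c)}=f^{(c-1)}*f$ for $c\ge1$, i.e. the $c$-fold Dirichlet convolution of $f$ with itself. For a set $S$ of positive integers, $\mathcal{C}_S$ is the class of arithmetical functions $f$ such that $(f*\mu)(d')\ge 0$ (in particular is real) whenever $d'\mid x$ for some $x\in S$. For a strictly increasing infinite sequence $\{x_i\}_{i=1}^\infty$ of positive integers, $\mathcal{C}$ is the class of arithmetical functions $f$ such that $(f*\mu)(d')\ge0$ whenever $d'\mid x$ for some $x\in\{x_i\}_{i=1}^\infty$. A function $f$ is multiplicative if $f(mn)=f(m)f(n)$ whenever $\gcd(m,n)=1$ (so $f(1)\in\{0,1\}$). *)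

theory Defs
  imports
    Complex_Main
    "HOL-Library.Complex_Order"
    "HOL-Computational_Algebra.Squarefree"
begin

text \<open>
  Arithmetical functions live on the positive integers. They are represented by functions on
  \<^typ>\<open>nat\<close> whose value at \<open>0\<close> is irrelevant: it never enters a convolution evaluated at a
  positive argument.
\<close>

type_synonym arith_fun = "nat \<Rightarrow> complex"

definition dirichlet_conv :: "arith_fun \<Rightarrow> arith_fun \<Rightarrow> arith_fun"  (infixl \<open>\<star>\<close> 70) where
  "f \<star> g = (\<lambda>m. \<Sum>d | d dvd m. f d * g (m div d))"

definition dirichlet_delta :: arith_fun where
  "dirichlet_delta m = (if m = 1 then 1 else 0)"

definition moebius :: arith_fun where
  "moebius m = (if squarefree m then (- 1) ^ card (prime_factors m) else 0)"

primrec conv_power :: "arith_fun \<Rightarrow> nat \<Rightarrow> arith_fun" where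
  "conv_power f 0 = dirichlet_delta"
| "conv_power f (Suc c) = conv_power f c \<star> f"

text \<open>\<open>conv_upto F c\<close> is the convolution of \<open>F 1, \<dots>, F c\<close>; index \<open>0\<close> is not used.\<close>

primrec conv_upto :: "(nat \<Rightarrow> arith_fun) \<Rightarrow> nat \<Rightarrow> arith_fun" where
  "conv_upto F 0 = dirichlet_delta"
| "conv_upto F (Suc c) = conv_upto F c \<star> F (Suc c)"

text \<open>
  In the order of \<^theory>\<open>HOL-Library.Complex_Order\<close>, \<open>0 \<le> z\<close> says that \<open>z\<close> is real and nonnegative.
\<close>

definition nonneg_class :: "nat set \<Rightarrow> arith_fun set" where
  "nonneg_class S = {f. \<forall>x\<in>S. \<forall>d'. d' dvd x \<longrightarrow> 0 \<le> (f \<star> moebius) d'}"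

text \<open>The zero function is multiplicative: \<open>f 1\<close> may be \<open>0\<close>.\<close>

definition multiplicative_arith :: "arith_fun \<Rightarrow> bool" where
  "multiplicative_arith f \<longleftrightarrow>
     (\<forall>m n. 0 < m \<longrightarrow> 0 < n \<longrightarrow> coprime m n \<longrightarrow> f (m * n) = f m * f n)"

end

theory Submission
  imports Defs
begin

text \<open>
  (i) The function to be bounded is a convolution of \<open>d + 1\<close> copies of \<open>\<mu>\<close> and at least as many
  factors \<open>f i\<close>. Pairing each \<open>\<mu>\<close> with some \<open>f i\<close> turns it into a convolution of factors
  \<open>f i \<star> \<mu>\<close> and \<open>f i\<close>. On the divisors of a member of \<open>S\<close> the former are nonnegative by
  hypothesis, the latter by Moebius inversion, and convolution preserves nonnegativity there.
  (ii) Evaluation at \<open>1\<close> is multiplicative, and evaluation at a prime is a derivation over it.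
\<close>

section \<open>Dirichlet convolution\<close>

text \<open>Every number divides 0, so the sum has an infinite index set and takes the default value
  0. This lets the algebraic laws below hold as equations of functions.\<close>

lemma dirichlet_conv_0 [simp]: "(f \<star> g) 0 = 0"
  by (simp add: dirichlet_conv_def)

text \<open>The sum over factorizations treats both factors alike, which turns commutativity and
  associativity into reindexings.\<close>

lemma dirichlet_conv_pairs:
  assumes "m > 0"
  shows "(f \<star> g) m = (\<Sum>(a, b) | a * b = m. f a * g b)"
  unfolding dirichlet_conv_def
  by (rule sum.reindex_bij_witness[of _ fst "\<lambda>d. (d, m div d)"]) (use assms in auto)

lemma dirichlet_conv_commute: "f \<star> g = g \<star> f"
proof
  fix m :: nat
  show "(f \<star> g) m = (g \<star> f) m"
  proof (cases "m = 0")
    case False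
    have "(\<Sum>(a, b) | a * b = m. f a * g b) = (\<Sum>(a, b) | a * b = m. g a * f b)"
      by (rule sum.reindex_bij_witness[of _ prod.swap prod.swap]) (auto simp: mult.commute)
    then show ?thesis
      using False by (simp add: dirichlet_conv_pairs)
  qed simp
qed

lemma finite_mult_eq:
  assumes "m > (0 :: nat)"
  shows "finite {(a, b). a * b = m}"
  by (rule finite_subset[of _ "{d. d dvd m} \<times> {d. d dvd m}"]) (use assms in auto)

lemma dirichlet_conv_assoc: "(f \<star> g) \<star> h = f \<star> (g \<star> h)"
proof
  fix m :: nat
  show "((f \<star> g) \<star> h) m = (f \<star> (g \<star> h)) m"
  proof (cases "m = 0")
    case False
    let ?P = "\<lambda>m. {(a, b). a * b = (m :: nat)}"
    have pos: "a > 0 \<and> b > 0" if "(a, b) \<in> ?P m" for a b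
      using that False by (auto intro!: Nat.gr0I)
    have "((f \<star> g) \<star> h) m = (\<Sum>(e, c)\<in>?P m. \<Sum>(a, b)\<in>?P e. f a * g b * h c)"
      using False pos
      by (auto simp: dirichlet_conv_pairs sum_distrib_right case_prod_unfold intro!: sum.cong)
    also have "\<dots> = (\<Sum>((e, c), (a, b))\<in>Sigma (?P m) (\<lambda>(e, c). ?P e). f a * g b * h c)"
      using False pos
      by (subst sum.Sigma [symmetric])
         (auto simp: case_prod_unfold intro!: finite_mult_eq[unfolded case_prod_unfold])
    \<comment> \<open>Both sums run over the triples of factors with product \<open>m\<close>; the
      bijection only moves the brackets.\<close>
    also have "\<dots> = (\<Sum>((a, e), (b, c))\<in>Sigma (?P m) (\<lambda>(a, e). ?P e). f a * (g b * h c))"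
      by (rule sum.reindex_bij_witness[of _ "\<lambda>((a, e), (b, c)). ((a * b, c), (a, b))"
            "\<lambda>((e, c), (a, b)). ((a, b * c), (b, c))"]) (auto simp: mult.assoc)
    also have "\<dots> = (\<Sum>(a, e)\<in>?P m. \<Sum>(b, c)\<in>?P e. f a * (g b * h c))"
      using False pos
      by (subst sum.Sigma [symmetric])
         (auto simp: case_prod_unfold intro!: finite_mult_eq[unfolded case_prod_unfold])
    also have "\<dots> = (f \<star> (g \<star> h)) m"
      using False pos
      by (auto simp: dirichlet_conv_pairs sum_distrib_left case_prod_unfold intro!: sum.cong)
    finally show ?thesis .
  qed simp
qed

lemma dirichlet_conv_left_commute: "f \<star> (g \<star> h) = g \<star> (f \<star> h)"
  by (metis dirichlet_conv_assoc dirichlet_conv_commute)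

lemmas dirichlet_conv_ac =
  dirichlet_conv_assoc dirichlet_conv_commute dirichlet_conv_left_commute

lemma dirichlet_conv_delta_left:
  assumes "m > 0"
  shows "(dirichlet_delta \<star> f) m = f m"
proof -
  have "(dirichlet_delta \<star> f) m = (\<Sum>d\<in>{1}. dirichlet_delta d * f (m div d))"
    unfolding dirichlet_conv_def
    by (rule sum.mono_neutral_right) (use assms in \<open>auto simp: dirichlet_delta_def\<close>)
  then show ?thesis
    by (simp add: dirichlet_delta_def)
qed

lemma dirichlet_conv_cong:
  assumes "\<And>d. d dvd m \<Longrightarrow> f d = f' d" "\<And>d. d dvd m \<Longrightarrow> g d = g' d"
  shows "(f \<star> g) m = (f' \<star> g') m"
proof (cases "m = 0")
  case False
  then show ?thesis
    unfolding dirichlet_conv_def using assms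
    by (intro sum.cong) auto
qed simp

text \<open>The unit law fails at 0 for an \<open>f\<close> with \<open>f 0\<close> nonzero.
  Convolutions vanish there, so for them it is an equation of functions.\<close>

lemma dirichlet_conv_delta_conv: "dirichlet_delta \<star> (f \<star> g) = f \<star> g"
proof
  show "(dirichlet_delta \<star> (f \<star> g)) m = (f \<star> g) m" for m
    by (cases "m = 0") (simp_all add: dirichlet_conv_delta_left)
qed

lemma dirichlet_conv_delta_delta: "dirichlet_delta \<star> dirichlet_delta = dirichlet_delta"
proof
  show "(dirichlet_delta \<star> dirichlet_delta) m = dirichlet_delta m" for m
    by (cases "m = 0") (simp_all add: dirichlet_conv_delta_left, simp add: dirichlet_delta_def)
qed

lemma dirichlet_delta_conv_power: "dirichlet_delta \<star> conv_power f n = conv_power f n"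
  by (cases n) (simp_all add: dirichlet_conv_delta_delta dirichlet_conv_delta_conv)

lemma conv_power_add: "conv_power f (m + n) = conv_power f m \<star> conv_power f n"
proof (induction n)
  case 0
  then show ?case
    by (metis add_0_right conv_power.simps(1) dirichlet_conv_commute dirichlet_delta_conv_power)
qed (simp add: dirichlet_conv_assoc)

section \<open>Moebius inversion\<close>

lemma moebius_1 [simp]: "moebius (Suc 0) = 1"
  by (simp add: moebius_def)

lemma moebius_mult_prime:
  assumes p: "prime (p :: nat)" and "\<not> p dvd m"
  shows "moebius (p * m) = - moebius m"
proof -
  have m: "m \<noteq> 0"
    using assms(2) by (metis dvd_0_right)
  have "squarefree (p * m) \<longleftrightarrow> squarefree m"
    using prime_imp_coprime[OF assms] squarefree_prime[OF p]
    by (auto intro: squarefree_mult_coprime dest: squarefree_multD)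
  moreover have "prime_factors (p * m) = insert p (prime_factors m)"
    using p m by (simp add: prime_factors_product prime_prime_factors)
  moreover have "p \<notin> prime_factors m"
    using assms by auto
  ultimately show ?thesis
    by (simp add: moebius_def)
qed

lemma moebius_prime:
  assumes "prime p"
  shows "moebius p = -1"
  using moebius_mult_prime[of p 1] assms by (auto simp: prime_nat_iff)

lemma sum_moebius_divisors:
  assumes "m > 0"
  shows "(\<Sum>d | d dvd m. moebius d) = dirichlet_delta m"
proof (cases "m = 1")
  case False
  then obtain p where p: "prime p" "p dvd m"
    using prime_factor_nat by blast
  let ?A = "{d. d dvd m \<and> squarefree d}"
  have fin: "finite {d. d dvd m}"
    using assms by simp
  \<comment> \<open>Once the terms with \<open>moebius d = 0\<close> are dropped, \<open>p\<close>
    divides each remaining \<open>d\<close> at most once, so \<open>d div p\<close> is free of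
    \<open>p\<close>.\<close>
  have "(\<Sum>d | d dvd m. moebius d) = (\<Sum>d\<in>?A. moebius d)"
    by (rule sum.mono_neutral_right) (use fin in \<open>auto simp: moebius_def\<close>)
  also have "\<dots> = (\<Sum>d\<in>{d \<in> ?A. p dvd d} \<union> {d \<in> ?A. \<not> p dvd d}. moebius d)"
    by (rule sum.cong) auto
  also have "\<dots> = (\<Sum>d\<in>{d \<in> ?A. p dvd d}. moebius d) + (\<Sum>d\<in>{d \<in> ?A. \<not> p dvd d}. moebius d)"
    by (rule sum.union_disjoint) (use fin in auto)
  \<comment> \<open>Multiplication by \<open>p\<close> matches the two halves and flips the sign.\<close>
  also have "(\<Sum>d\<in>{d \<in> ?A. p dvd d}. moebius d) = (\<Sum>d\<in>{d \<in> ?A. \<not> p dvd d}. - moebius d)"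
  proof (rule sum.reindex_bij_witness[of _ "\<lambda>d. p * d" "\<lambda>d. d div p"])
    fix d assume d: "d \<in> {d \<in> ?A. p dvd d}"
    then obtain e where e: "d = p * e" by auto
    have p0: "p > 0" "\<not> p dvd 1" using p(1) by (auto simp: prime_gt_0_nat prime_nat_iff)
    have "\<not> p dvd e"
    proof
      assume "p dvd e"
      then have "p\<^sup>2 dvd d" using e by (simp add: power2_eq_square)
      then show False using d p0 by (auto simp: squarefree_def)
    qed
    moreover have "squarefree e" "e dvd m"
      using d e by (auto dest: squarefree_multD dvd_mult_right)
    ultimately show "d div p \<in> {d \<in> ?A. \<not> p dvd d}" "- moebius (d div p) = moebius d"
      using e p0 moebius_mult_prime[OF p(1)] by auto
    show "p * (d div p) = d" using d by auto
  next
    fix d assume d: "d \<in> {d \<in> ?A. \<not> p dvd d}"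
    then have cop: "coprime p d"
      using p(1) prime_imp_coprime by blast
    show "p * d div p = d" using p(1) by (auto simp: prime_gt_0_nat)
    show "p * d \<in> {d \<in> ?A. p dvd d}"
      using d p cop by (auto intro: divides_mult squarefree_mult_coprime squarefree_prime)
  qed
  also have "\<dots> + (\<Sum>d\<in>{d \<in> ?A. \<not> p dvd d}. moebius d) = 0"
    by (simp add: sum_negf)
  finally show ?thesis
    using False by (simp add: dirichlet_delta_def)
qed (simp add: dirichlet_delta_def)

lemma moebius_inversion:
  assumes "m > 0"
  shows "((f \<star> moebius) \<star> (\<lambda>_. 1)) m = f m"
proof -
  have "((f \<star> moebius) \<star> (\<lambda>_. 1)) m = ((moebius \<star> (\<lambda>_. 1)) \<star> f) m"
    by (simp add: dirichlet_conv_ac)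
  also have "\<dots> = (dirichlet_delta \<star> f) m"
    by (rule dirichlet_conv_cong)
       (use assms in \<open>auto simp: dirichlet_conv_def sum_moebius_divisors dest: dvd_pos_nat\<close>)
  finally show ?thesis
    using assms by (simp add: dirichlet_conv_delta_left)
qed

section \<open>Nonnegativity on the divisors of a number\<close>

text \<open>The class condition concerns each \<open>x\<close> separately. The divisors of one
  \<open>x\<close> are closed under taking divisors, so convolution can be studied on them
  alone.\<close>

definition nonneg_divisors :: "nat \<Rightarrow> arith_fun \<Rightarrow> bool" where
  "nonneg_divisors x f \<longleftrightarrow> (\<forall>m. m dvd x \<longrightarrow> 0 \<le> f m)"

lemma nonneg_class_iff: "f \<in> nonneg_class S \<longleftrightarrow> (\<forall>x\<in>S. nonneg_divisors x (f \<star> moebius))"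
  by (auto simp: nonneg_class_def nonneg_divisors_def)

lemma nonneg_divisors_conv:
  assumes "x > 0" "nonneg_divisors x f" "nonneg_divisors x g"
  shows "nonneg_divisors x (f \<star> g)"
  unfolding nonneg_divisors_def dirichlet_conv_def
proof (intro allI impI sum_nonneg)
  fix m d assume "m dvd x" "d \<in> {d. d dvd m}"
  then have "d dvd x" "m div d dvd x"
    by (auto elim!: dvdE)
  then show "0 \<le> f d * g (m div d)"
    using assms by (simp add: nonneg_divisors_def)
qed

lemma nonneg_divisors_delta: "nonneg_divisors x dirichlet_delta"
  by (simp add: nonneg_divisors_def dirichlet_delta_def less_eq_complex_def)

text \<open>Inversion writes \<open>f\<close> as the convolution of \<open>f \<star> moebius\<close>
  with the nonnegative constant 1.\<close>

lemma nonneg_divisors_of_conv_moebius: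
  assumes "x > 0" "nonneg_divisors x (f \<star> moebius)"
  shows "nonneg_divisors x f"
proof -
  have "nonneg_divisors x ((f \<star> moebius) \<star> (\<lambda>_. 1))"
    by (rule nonneg_divisors_conv) (use assms in \<open>auto simp: nonneg_divisors_def less_eq_complex_def\<close>)
  then show ?thesis
    using assms(1) unfolding nonneg_divisors_def by (metis dvd_pos_nat moebius_inversion)
qed

text \<open>Since \<open>b \<le> n\<close>, each \<open>moebius\<close> gets its own partner
  \<open>f\<close>; the copies of \<open>f\<close> left over are nonnegative themselves.\<close>

lemma nonneg_divisors_conv_power:
  assumes x: "x > 0" and f: "nonneg_divisors x (f \<star> moebius)" and "b \<le> n"
  shows "nonneg_divisors x (conv_power f n \<star> conv_power moebius b)"
  using \<open>b \<le> n\<close>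
proof (induction n arbitrary: b)
  case 0
  then show ?case
    by (simp add: dirichlet_conv_delta_delta nonneg_divisors_delta)
next
  case (Suc n)
  show ?case
  proof (cases b)
    case 0
    have "nonneg_divisors x ((conv_power f n \<star> conv_power moebius 0) \<star> f)"
      by (rule nonneg_divisors_conv[OF x Suc.IH nonneg_divisors_of_conv_moebius[OF x f]]) simp
    then show ?thesis
      using 0 by (simp add: dirichlet_conv_ac)
  next
    case (Suc b')
    \<comment> \<open>The new copy of \<open>f\<close> takes one \<open>moebius\<close>, leaving
      \<open>b'\<close> of them for the other \<open>n\<close> copies.\<close>
    have "nonneg_divisors x ((conv_power f n \<star> conv_power moebius b') \<star> (f \<star> moebius))"
      by (rule nonneg_divisors_conv[OF x Suc.IH f]) (use Suc.prems Suc in simp)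
    then show ?thesis
      using Suc by (simp add: dirichlet_conv_ac)
  qed
qed

lemma nonneg_divisors_conv_upto:
  assumes x: "x > 0" and "\<forall>i\<in>{1..c}. nonneg_divisors x (f i \<star> moebius)"
    and "d \<le> (\<Sum>i=1..c. l i)"
  shows "nonneg_divisors x (conv_upto (\<lambda>i. conv_power (f i) (l i)) c \<star> conv_power moebius d)"
  using assms(2,3)
proof (induction c arbitrary: d)
  case 0
  then show ?case
    by (simp add: dirichlet_conv_delta_delta nonneg_divisors_delta)
next
  case (Suc c)
  \<comment> \<open>Greedy split: the first \<open>c\<close> blocks absorb as many copies of
    \<open>moebius\<close> as they have factors, and the bound on \<open>d\<close> makes the rest
    fit into the last block.\<close>
  define a where "a = min d (\<Sum>i=1..c. l i)"
  define b where "b = d - a"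
  have ab: "d = a + b" "a \<le> (\<Sum>i=1..c. l i)" "b \<le> l (Suc c)"
    using Suc.prems(2) by (auto simp: a_def b_def)
  let ?U = "conv_upto (\<lambda>i. conv_power (f i) (l i)) c"
  let ?V = "conv_power (f (Suc c)) (l (Suc c))"
  have "nonneg_divisors x ((?U \<star> conv_power moebius a) \<star> (?V \<star> conv_power moebius b))"
  proof (rule nonneg_divisors_conv[OF x])
    show "nonneg_divisors x (?U \<star> conv_power moebius a)"
      using Suc.IH Suc.prems(1) ab(2) by auto
    show "nonneg_divisors x (?V \<star> conv_power moebius b)"
      using Suc.prems(1) ab(3) x by (intro nonneg_divisors_conv_power) auto
  qed
  then show ?case
    using ab(1) by (simp add: conv_power_add dirichlet_conv_ac)
qed

lemma conv_upto_in_nonneg_class: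
  assumes "\<forall>x\<in>S. 0 < x" "\<forall>i\<in>{1..c}. f i \<in> nonneg_class S" "d < (\<Sum>i=1..c. l i)"
  shows "conv_upto (\<lambda>i. conv_power (f i) (l i)) c \<star> conv_power moebius d \<in> nonneg_class S"
  unfolding nonneg_class_iff
proof
  fix x assume "x \<in> S"
  \<comment> \<open>The class condition brings one more \<open>moebius\<close>, and the strict bound
    on \<open>d\<close> leaves room for it.\<close>
  then have "nonneg_divisors x
      (conv_upto (\<lambda>i. conv_power (f i) (l i)) c \<star> conv_power moebius (Suc d))"
    using assms by (intro nonneg_divisors_conv_upto) (auto simp: nonneg_class_iff)
  then show "nonneg_divisors x
      (conv_upto (\<lambda>i. conv_power (f i) (l i)) c \<star> conv_power moebius d \<star> moebius)"
    by (simp add: dirichlet_conv_assoc)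
qed

section \<open>Values at primes\<close>

lemma dirichlet_conv_1: "(f \<star> g) (Suc 0) = f (Suc 0) * g (Suc 0)"
  by (simp add: dirichlet_conv_def)

text \<open>A prime has only the factorizations \<open>1 * p\<close> and \<open>p * 1\<close>. This
  is the Leibniz rule behind the formulas below.\<close>

lemma dirichlet_conv_prime:
  assumes "prime p"
  shows "(f \<star> g) p = f 1 * g p + f p * g 1"
proof -
  have "{d. d dvd p} = {1, p}" "p \<noteq> 1" "p > 0"
    using assms by (auto simp: prime_nat_iff)
  then show ?thesis
    by (simp add: dirichlet_conv_def)
qed

lemma conv_power_1: "conv_power f n (Suc 0) = f (Suc 0) ^ n"
  by (induction n) (simp_all add: dirichlet_delta_def dirichlet_conv_1)

lemma conv_power_prime:
  assumes "prime p"
  shows "conv_power f n p = of_nat n * f p * f 1 ^ (n - 1)"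
proof (induction n)
  case 0
  then show ?case
    using assms by (auto simp: dirichlet_delta_def)
next
  case (Suc n)
  then show ?case
    \<comment> \<open>The split keeps the truncated exponent \<open>n - 1\<close> honest:
      \<open>f 1 * f 1 ^ (n - 1)\<close> is \<open>f 1 ^ n\<close> only for positive
      \<open>n\<close>.\<close>
    using assms by (cases n) 
      (auto simp: dirichlet_conv_prime dirichlet_conv_1 conv_power_1 dirichlet_delta_def algebra_simps)
qed

lemma conv_upto_1: "conv_upto F c (Suc 0) = (\<Prod>i=1..c. F i (Suc 0))"
  by (induction c) (simp_all add: dirichlet_delta_def dirichlet_conv_1)

text \<open>Iterated Leibniz rule: one factor is evaluated at \<open>p\<close>, all others at
  1.\<close>

lemma conv_upto_prime:
  assumes "prime p"
  shows "conv_upto F c p = (\<Sum>i=1..c. F i p * (\<Prod>j\<in>{1..c} - {i}. F j 1))"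
proof (induction c)
  case 0
  then show ?case
    using assms by (auto simp: dirichlet_delta_def)
next
  case (Suc c)
  have "(\<Prod>j\<in>{1..Suc c} - {i}. F j 1) = (\<Prod>j\<in>{1..c} - {i}. F j 1) * F (Suc c) 1"
    if "i \<in> {1..c}" for i
  proof -
    have "{1..Suc c} - {i} = insert (Suc c) ({1..c} - {i})"
      using that by auto
    then show ?thesis
      by simp
  qed
  moreover have "{1..Suc c} - {Suc c} = {1..c}"
    by auto
  ultimately show ?case
    using assms Suc
    by (simp add: dirichlet_conv_prime conv_upto_1 sum_distrib_left algebra_simps)
qed

text \<open>The power of \<open>moebius\<close> has value 1 at 1 and \<open>- of_nat d\<close> at
  \<open>p\<close>, which yields the subtracted term.\<close>

lemma conv_upto_moebius_prime:
  assumes "prime p"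
  shows "(conv_upto (\<lambda>i. conv_power (f i) (l i)) c \<star> conv_power moebius d) p =
      (\<Sum>i=1..c. of_nat (l i) * f i p * f i 1 ^ (l i - 1) * (\<Prod>j\<in>{1..c} - {i}. f j 1 ^ l j))
        - of_nat d * (\<Prod>i=1..c. f i 1 ^ l i)"
  using assms
  by (simp add: dirichlet_conv_prime conv_power_1 conv_power_prime conv_upto_1 conv_upto_prime
      moebius_prime)

text \<open>Every \<open>m\<close> is coprime to 1, so \<open>f 1\<close> is a factor of
  \<open>f m\<close>.\<close>

lemma multiplicative_arith_zero:
  assumes "multiplicative_arith f" "f 1 = 0" "m > 0"
  shows "f m = 0"
proof -
  have "f (m * 1) = f m * f 1"
    using assms(3) by (intro assms(1)[unfolded multiplicative_arith_def, rule_format]) auto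
  then show ?thesis
    using assms(2) by simp
qed

theorem theorem1p1:
  fixes c d :: nat
    and f :: "nat \<Rightarrow> arith_fun"
    and l :: "nat \<Rightarrow> nat"
  assumes c: "1 \<le> c"
    and distinct: "\<forall>i\<in>{1..c}. \<forall>j\<in>{1..c}. i \<noteq> j \<longrightarrow> (\<exists>m>0. f i m \<noteq> f j m)"
    and l_pos: "\<forall>i\<in>{1..c}. 0 < l i"
  shows
    "(\<forall>x :: nat \<Rightarrow> nat. strict_mono_on {1..} x \<longrightarrow> (\<forall>k\<ge>1. 0 < x k) \<longrightarrow> (\<Sum>i=1..c. l i) > d \<longrightarrow>
        (\<forall>n\<ge>1. (\<forall>i\<in>{1..c}. f i \<in> nonneg_class (x ` {1..n})) \<longrightarrow>
           conv_upto (\<lambda>i. conv_power (f i) (l i)) c \<star> conv_power moebius d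
             \<in> nonneg_class (x ` {1..n})) \<and>
        ((\<forall>i\<in>{1..c}. f i \<in> nonneg_class (x ` {1..})) \<longrightarrow>
           conv_upto (\<lambda>i. conv_power (f i) (l i)) c \<star> conv_power moebius d
             \<in> nonneg_class (x ` {1..}))) \<and>
     (\<forall>p :: nat. prime p \<longrightarrow>
        (conv_upto (\<lambda>i. conv_power (f i) (l i)) c \<star> conv_power moebius d) p =
          (\<Sum>i=1..c. of_nat (l i) * f i p * f i 1 ^ (l i - 1) * (\<Prod>j\<in>{1..c} - {i}. f j 1 ^ l j))
            - of_nat d * (\<Prod>i=1..c. f i 1 ^ l i) \<and>
        ((\<forall>i\<in>{1..c}. multiplicative_arith (f i)) \<longrightarrow>
           ((\<forall>i\<in>{1..c}. f i 1 = 1) \<longrightarrow>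
              (conv_upto (\<lambda>i. conv_power (f i) (l i)) c \<star> conv_power moebius d) p =
                (\<Sum>i=1..c. of_nat (l i) * f i p) - of_nat d) \<and>
           ((\<exists>i\<in>{1..c}. f i 1 = 0) \<longrightarrow>
              (conv_upto (\<lambda>i. conv_power (f i) (l i)) c \<star> conv_power moebius d) p = 0)))"
proof (intro conjI allI impI)
  fix x :: "nat \<Rightarrow> nat" and n :: nat
  assume "\<forall>k\<ge>1. 0 < x k" "(\<Sum>i=1..c. l i) > d"
    "\<forall>i\<in>{1..c}. f i \<in> nonneg_class (x ` {1..n})"
  then show "conv_upto (\<lambda>i. conv_power (f i) (l i)) c \<star> conv_power moebius d
      \<in> nonneg_class (x ` {1..n})"
    by (intro conv_upto_in_nonneg_class) auto
next
  fix x :: "nat \<Rightarrow> nat"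
  assume "\<forall>k\<ge>1. 0 < x k" "(\<Sum>i=1..c. l i) > d"
    "\<forall>i\<in>{1..c}. f i \<in> nonneg_class (x ` {1..})"
  then show "conv_upto (\<lambda>i. conv_power (f i) (l i)) c \<star> conv_power moebius d
      \<in> nonneg_class (x ` {1..})"
    by (intro conv_upto_in_nonneg_class) auto
next
  fix p :: nat
  assume p: "prime p"
  show "(conv_upto (\<lambda>i. conv_power (f i) (l i)) c \<star> conv_power moebius d) p =
      (\<Sum>i=1..c. of_nat (l i) * f i p * f i 1 ^ (l i - 1) * (\<Prod>j\<in>{1..c} - {i}. f j 1 ^ l j))
        - of_nat d * (\<Prod>i=1..c. f i 1 ^ l i)"
    by (rule conv_upto_moebius_prime[OF p])
  {
    assume "\<forall>i\<in>{1..c}. f i 1 = 1"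
    then show "(conv_upto (\<lambda>i. conv_power (f i) (l i)) c \<star> conv_power moebius d) p =
        (\<Sum>i=1..c. of_nat (l i) * f i p) - of_nat d"
      unfolding conv_upto_moebius_prime[OF p] by simp
  }
  assume mult: "\<forall>i\<in>{1..c}. multiplicative_arith (f i)" and "\<exists>i\<in>{1..c}. f i 1 = 0"
  then obtain k where k: "k \<in> {1..c}" "f k 1 = 0"
    by blast
  \<comment> \<open>This kills the summand \<open>i = k\<close>, where
    \<open>f k 1 ^ (l k - 1)\<close> would be 1 if \<open>l k = 1\<close>. In every other summand
    the product still contains \<open>f k 1 ^ l k\<close>, which is 0 because \<open>l k\<close> is
    positive.\<close>
  have "f k p = 0"
    using mult k p by (metis multiplicative_arith_zero prime_gt_0_nat)
  moreover have prod_0: "(\<Prod>j\<in>A. f j 1 ^ l j) = 0" if "k \<in> A" "finite A" for A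
    using that k l_pos by (intro prod_zero) (auto intro!: bexI[of _ k])
  ultimately have "of_nat (l i) * f i p * f i 1 ^ (l i - 1) * (\<Prod>j\<in>{1..c} - {i}. f j 1 ^ l j) = 0"
    for i
    using k(1) by (cases "i = k") (simp_all only: prod_0 finite_Diff finite_atLeastAtMost
        Diff_iff singleton_iff simp_thms mult_zero_left mult_zero_right)
  then have "(\<Sum>i=1..c. of_nat (l i) * f i p * f i 1 ^ (l i - 1) *
      (\<Prod>j\<in>{1..c} - {i}. f j 1 ^ l j)) = 0"
    by (intro sum.neutral) blast
  then show "(conv_upto (\<lambda>i. conv_power (f i) (l i)) c \<star> conv_power moebius d) p = 0"
    by (simp only: conv_upto_moebius_prime[OF p] prod_0[OF k(1) finite_atLeastAtMost]
        mult_zero_right diff_self)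
qed

end
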